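(* Let $\mathbb{F}$ be a field, let $X$ be a vector space over $\mathbb{F}$, and let $f, g\colon\mathbb{F}\to X$ be functions. Then \[ f(x+y)-f(x)-f(y)=g(xy)-xg(y)-yg(x) \] holds for all $x, y\in\mathbb{F}$ if and only if there exist additive functions $\alpha, \beta\colon\mathbb{F}\to X$ and a function $\varphi\colon\mathbb{F}\to X$ with the property \[ \varphi(xy)=x\varphi(y)+y\varphi(x)\qquad (x, y\in\mathbb{F}), \] such that \[ f(x)=\beta(x)+\frac{1}{2}\alpha(x^{2})-x\alpha(x)\qquad (x\in\mathbb{F}) \] and \[ g(x)=\varphi(x)+\alpha(x)\qquad (x\in\mathbb{F}) \] are satisfied.
   Context: A function $h\colon\mathbb{F}\to X$ is called additive if $h(x+y)=h(x)+h(y)$ for all $x,y\in\mathbb{F}$. Expressions such as $x\,g(y)$ denote multiplication of the vector $g(y)\in X$ by the scalar $x\in\mathbb{F}$. The function $\varphi$ is not assumed to be additive.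
   Formalization: The field F is assumed to have characteristic different from 2, since the scalar 1/2 in the formula for f does not exist in characteristic 2. *)

theory Defs
  imports Complex_Main
begin

end

theory Submission
  imports Defs "HOL-Computational_Algebra.Primes" "HOL-Library.Product_Plus"
begin

text \<open>
  Put $G(x,y) = g(xy) - x g(y) - y g(x)$. Being the defect of $g$ from the rule
  $\varphi(xy) = x\varphi(y) + y\varphi(x)$, the function $G$ is a symmetric Hochschild cocycle for
  the multiplication of the field. The functional equation says that $G$ is also the Cauchy
  difference of $f$, so $G$ is a cocycle for the addition as well. These two identities force $G$
  to be biadditive (\<open>biadditive_if_additive_cocycle\<close>).

  The heart of the matter is to write a biadditive $G$ as
  $G(x,y) = \alpha(xy) - x\alpha(y) - y\alpha(x)$ with an additive $\alpha$. Then
  $\varphi = g - \alpha$ satisfies the product rule, and $f$ has the same Cauchy difference as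
  $\frac12\alpha(x^2) - x\alpha(x)$, so the two differ by an additive $\beta$.

  To find $\alpha$, twist the multiplication of the dual numbers $F \oplus X$ by $G$:
  $(x,u)(y,v) = (xy,\, xv + yu + G(x,y))$. This is a commutative ring, because $G$ is a symmetric
  biadditive Hochschild cocycle. The first projection maps it onto the field $F$ with a kernel of
  square zero, and a ring homomorphism $\sigma$ that splits this projection is exactly a map
  $x \mapsto (x, \alpha(x))$ with the required $\alpha$. So the theorem rests on the case of Cohen's
  structure theorem for a kernel of square zero and equal characteristic, the existence of a
  coefficient field (\<open>coefficient_field_exists\<close>).

  That theorem follows from Zorn's lemma, applied to the subrings on which the projection is
  injective and which contain all $p$-th powers, where $p$ is the characteristic (for $p = 0$ this
  only asks for the unit element). If the image of a maximal such subring $L$ misses $t$, one of the lifts $r$ of $t$ can be adjoined to $L$, a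
  contradiction: any lift, when $t$ is transcendental over the image; a lift that solves the
  minimal equation of $t$, found by a Newton step, when this equation is separable; and again any
  lift when it is not, because then the minimal equation is $T^p = t^p$, and $r^p \in L$ makes every
  lift a solution.
\<close>

section \<open>Coefficient fields of square-zero extensions\<close>

text \<open>
  The statements live in the class context \<open>comm_ring_1\<close>, not over a type of that class,
  because they are later interpreted in a ring whose multiplication depends on a cocycle and so is
  available only locally.
\<close>

context comm_ring_1
begin

text \<open>
  The subrings to which Zorn's lemma is applied. If $\pi$ maps $L$ onto the field, the inverse of
  $\pi$ on $L$ is a splitting. In positive characteristic $p$ the powers have to be in $L$ from the
  start: two lifts of $t$ have the same $p$-th power, hence a splitting sends $t^p$ to it, but a
  subring without it could contain a different lift of $t^p$, and then no lift of $t$ could be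
  adjoined. In characteristic zero the condition reads $1 \in L$.
\<close>
definition partial_section :: "('a \<Rightarrow> 'k::field) \<Rightarrow> 'a set \<Rightarrow> bool" where
  "partial_section \<pi> L \<longleftrightarrow>
     1 \<in> L \<and> (\<forall>x\<in>L. \<forall>y\<in>L. x + y \<in> L \<and> x * y \<in> L) \<and> (\<forall>x\<in>L. - x \<in> L) \<and>
     (\<forall>x\<in>L. \<pi> x = 0 \<longrightarrow> x = 0) \<and> range (\<lambda>x. x ^ CHAR('k)) \<subseteq> L"

definition maximal_section :: "('a \<Rightarrow> 'k::field) \<Rightarrow> 'a set \<Rightarrow> bool" where
  "maximal_section \<pi> L \<longleftrightarrow> partial_section \<pi> L \<and> (\<forall>M. partial_section \<pi> M \<longrightarrow> L \<subseteq> M \<longrightarrow> M = L)"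

inductive_set adjoin :: "'a set \<Rightarrow> 'a \<Rightarrow> 'a set" for L r where
  base: "x \<in> L \<Longrightarrow> x \<in> adjoin L r"
| add: "x \<in> adjoin L r \<Longrightarrow> y \<in> adjoin L r \<Longrightarrow> x + y \<in> adjoin L r"
| mult: "x \<in> adjoin L r \<Longrightarrow> r * x \<in> adjoin L r"

definition poly_values :: "'a set \<Rightarrow> 'a \<Rightarrow> nat \<Rightarrow> 'a set" where
  "poly_values L r n = {\<Sum>i<n. a i * r ^ i | a. range a \<subseteq> L}"

definition independent_powers :: "('a \<Rightarrow> 'k::field) \<Rightarrow> 'a set \<Rightarrow> 'k \<Rightarrow> nat \<Rightarrow> bool" where
  "independent_powers \<pi> L t n \<longleftrightarrow>
     (\<forall>a. range a \<subseteq> L \<longrightarrow> (\<Sum>i<n. \<pi> (a i) * t ^ i) = 0 \<longrightarrow> (\<forall>i<n. \<pi> (a i) = 0))"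

text \<open>
  Here $\pi$ is the residue map of a square-zero extension of a field. Equal characteristic is
  indispensable: $\mathbb{Z}/p^2 \to \mathbb{Z}/p$ has a kernel of square zero, but no splitting.
\<close>

context
  fixes \<pi> :: "'a \<Rightarrow> 'k::field"
  assumes \<pi>_add: "\<pi> (x + y) = \<pi> x + \<pi> y"
    and \<pi>_mult: "\<pi> (x * y) = \<pi> x * \<pi> y"
    and \<pi>_one: "\<pi> 1 = 1"
    and surj_\<pi>: "surj \<pi>"
    and kernel_square_zero: "\<pi> x = 0 \<Longrightarrow> \<pi> y = 0 \<Longrightarrow> x * y = 0"
    and equal_characteristic: "of_nat CHAR('k) = (0 :: 'a)"
begin

lemma \<pi>_zero: "\<pi> 0 = 0"
  using \<pi>_add[of 0 0] by (metis add_0 cancel_comm_monoid_add_class.add_cancel_right_right)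

lemma \<pi>_uminus: "\<pi> (- x) = - \<pi> x"
  using \<pi>_add[of x "- x"] by (simp add: \<pi>_zero group_add_class.eq_neg_iff_add_eq_0 ab_semigroup_add_class.add.commute)

lemma \<pi>_diff: "\<pi> (x - y) = \<pi> x - \<pi> y"
  using \<pi>_add[of x "- y"] by (simp add: \<pi>_uminus)

lemma \<pi>_power: "\<pi> (x ^ n) = \<pi> x ^ n"
  by (induction n) (simp_all add: \<pi>_one \<pi>_mult)

lemma \<pi>_of_nat: "\<pi> (of_nat n) = of_nat n"
  by (induction n) (simp_all add: \<pi>_zero \<pi>_add \<pi>_one)

lemma \<pi>_of_int: "\<pi> (of_int n) = of_int n"
  by (cases n) (simp_all add: \<pi>_of_nat \<pi>_uminus \<pi>_diff \<pi>_one)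

lemma \<pi>_sum: "\<pi> (\<Sum>i<n. f i) = (\<Sum>i<n. \<pi> (f i))" for n :: nat
  by (induction n) (simp_all add: \<pi>_zero \<pi>_add)

lemmas \<pi>_simps = \<pi>_zero \<pi>_one \<pi>_add \<pi>_mult \<pi>_uminus \<pi>_diff \<pi>_power \<pi>_of_nat \<pi>_of_int \<pi>_sum

text \<open>
  A lift $z$ of the inverse of $\pi(s)$ gives $sz = 1 + e$ with $e^2 = 0$, and
  $(1+e)(1-e) = 1$.
\<close>
lemma unit_if_\<pi>_nonzero:
  assumes "\<pi> s \<noteq> 0"
  obtains u where "s * u = 1"
proof -
  obtain z where z: "\<pi> z = inverse (\<pi> s)"
    by (metis surj_\<pi> surjD)
  define e where "e = s * z - 1"
  have "\<pi> e = 0"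
    using assms by (simp add: e_def \<pi>_simps z)
  then have ee: "e * e = 0"
    by (intro kernel_square_zero)
  have "s * z = 1 + e"
    by (simp add: e_def algebra_simps)
  then have "s * (z * (1 - e)) = (1 + e) * (1 - e)"
    by (metis mult.assoc)
  also have "\<dots> = 1"
    using ee by (simp add: algebra_simps)
  finally show thesis
    by (rule that)
qed

lemma CHAR_eq_CHAR_residue: "CHAR('a) = CHAR('k)"
proof (rule CHAR_eqI)
  fix n
  assume "of_nat n = (0 :: 'a)"
  then have "of_nat n = (0 :: 'k)"
    using \<pi>_of_nat[of n] by (simp add: \<pi>_zero)
  then show "CHAR('k) dvd n"
    by (simp add: semiring_1_class.of_nat_eq_0_iff_char_dvd)
qed (rule equal_characteristic)

lemma partial_sectionD:
  assumes "partial_section \<pi> L"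
  shows "1 \<in> L" "0 \<in> L" "x \<in> L \<Longrightarrow> y \<in> L \<Longrightarrow> x + y \<in> L"
    "x \<in> L \<Longrightarrow> y \<in> L \<Longrightarrow> x * y \<in> L" "x \<in> L \<Longrightarrow> - x \<in> L"
    "x \<in> L \<Longrightarrow> y \<in> L \<Longrightarrow> x - y \<in> L"
    "x \<in> L \<Longrightarrow> \<pi> x = 0 \<Longrightarrow> x = 0" "x ^ CHAR('k) \<in> L"
proof -
  show 1: "1 \<in> L" and add: "x \<in> L \<Longrightarrow> y \<in> L \<Longrightarrow> x + y \<in> L" for x y
    using assms by (simp_all add: partial_section_def)
  show "x \<in> L \<Longrightarrow> y \<in> L \<Longrightarrow> x * y \<in> L" "x \<in> L \<Longrightarrow> \<pi> x = 0 \<Longrightarrow> x = 0" "x ^ CHAR('k) \<in> L"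
    using assms by (simp_all add: partial_section_def image_subset_iff)
  show minus: "x \<in> L \<Longrightarrow> - x \<in> L" for x
    using assms by (simp add: partial_section_def)
  show "0 \<in> L"
    using add[OF 1 minus[OF 1]] by simp
  show "x \<in> L \<Longrightarrow> y \<in> L \<Longrightarrow> x - y \<in> L"
    using add[of x "- y"] minus[of y] by simp
qed

lemma of_nat_in_partial_section:
  assumes "partial_section \<pi> L"
  shows "of_nat n \<in> L"
  by (induction n) (simp_all add: partial_sectionD(1-3)[OF assms])

text \<open>
  In characteristic zero the integers serve. In characteristic $p$ the set of all $p$-th powers
  serves: it is closed under addition because the Frobenius map is a ring homomorphism, and a $p$-th
  power $a^p$ with residue zero vanishes because $a$ lies in the kernel, so that already $a^2 = 0$.
\<close>
lemma partial_section_exists: "\<exists>L. partial_section \<pi> L"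
proof (cases "CHAR('k) = 0")
  case True
  have "partial_section \<pi> (range of_int)"
    unfolding partial_section_def
  proof (intro conjI ballI impI)
    fix x y :: 'a
    assume "x \<in> range of_int" "y \<in> range of_int"
    then obtain m n where "x = of_int m" "y = of_int n"
      by blast
    then show "x + y \<in> range of_int" "x * y \<in> range of_int"
      by (auto intro: range_eqI[of _ _ "m + n"] range_eqI[of _ _ "m * n"])
  next
    fix x :: 'a
    assume "x \<in> range of_int"
    then obtain n where n: "x = of_int n"
      by blast
    then show "- x \<in> range of_int"
      by (auto intro: range_eqI[of _ _ "- n"])
    assume "\<pi> x = 0"
    then have "of_int n = (0 :: 'k)"
      by (simp add: n \<pi>_simps)
    moreover obtain m where m: "n = int m \<or> n = - int m"
      by (metis int_cases2)
    ultimately have "of_nat m = (0 :: 'k)"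
      by auto
    then have "m = 0"
      using True by (simp add: semiring_1_class.of_nat_eq_0_iff_char_dvd)
    then show "x = 0"
      using m by (auto simp: n)
  next
    show "1 \<in> range of_int"
      using rangeI[of of_int "1 :: int"] by simp
    then show "range (\<lambda>x. x ^ CHAR('k)) \<subseteq> range of_int"
      using True by auto
  qed
  then show ?thesis ..
next
  case False
  define p where "p = CHAR('k)"
  have prime: "prime p"
    using False prime_CHAR_semidom[where 'a = 'k] by (simp add: p_def)
  have frob: "(x + y) ^ p = x ^ p + y ^ p" for x y
    using prime by (intro freshmans_dream) (simp_all add: CHAR_eq_CHAR_residue p_def)
  have zero: "0 ^ p = 0"
    using prime_gt_0_nat[OF prime] by (simp add: power_0_left)
  have "partial_section \<pi> (range (\<lambda>x. x ^ p))"
    unfolding partial_section_def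
  proof (intro conjI ballI impI)
    fix x y :: 'a
    assume "x \<in> range (\<lambda>x. x ^ p)" "y \<in> range (\<lambda>x. x ^ p)"
    then obtain a b where "x = a ^ p" "y = b ^ p"
      by blast
    then show "x + y \<in> range (\<lambda>x. x ^ p)" "x * y \<in> range (\<lambda>x. x ^ p)"
      by (auto intro: range_eqI[of _ _ "a + b"] range_eqI[of _ _ "a * b"] simp: frob power_mult_distrib)
  next
    fix x :: 'a
    assume "x \<in> range (\<lambda>x. x ^ p)"
    then obtain a where a: "x = a ^ p"
      by blast
    have "x + (- a) ^ p = 0"
      by (simp add: a zero flip: frob)
    then show "- x \<in> range (\<lambda>x. x ^ p)"
      by (intro range_eqI[of _ _ "- a"] minus_unique)
    assume "\<pi> x = 0"
    then have "\<pi> a = 0"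
      by (simp add: a \<pi>_simps)
    then have "a * a = 0"
      by (intro kernel_square_zero)
    moreover obtain k where "p = Suc (Suc k)"
      using prime_ge_2_nat[OF prime] by (metis add_2_eq_Suc le_Suc_ex)
    ultimately show "x = 0"
      by (simp add: a flip: mult.assoc)
  next
    show "1 \<in> range (\<lambda>x. x ^ p)"
      using rangeI[of "\<lambda>x. x ^ p" 1] by simp
  qed (simp add: p_def)
  then show ?thesis ..
qed

lemma partial_section_Union:
  assumes "C \<noteq> {}" "subset.chain {L. partial_section \<pi> L} C"
  shows "partial_section \<pi> (\<Union>C)"
proof -
  have mem: "partial_section \<pi> L" if "L \<in> C" for L
    using that assms(2) by (auto simp: subset_chain_def)
  have common: "\<exists>L\<in>C. x \<in> L \<and> y \<in> L" if "x \<in> \<Union>C" "y \<in> \<Union>C" for x y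
    using that assms(2) unfolding subset_chain_def by blast
  show ?thesis
    unfolding partial_section_def
  proof (intro conjI ballI impI)
    fix x y
    assume "x \<in> \<Union>C" "y \<in> \<Union>C"
    then obtain L where "L \<in> C" "x \<in> L" "y \<in> L"
      using common by blast
    then show "x + y \<in> \<Union>C" "x * y \<in> \<Union>C"
      using mem partial_sectionD(3,4) by blast+
  next
    fix x
    assume "x \<in> \<Union>C"
    then obtain L where L: "L \<in> C" "x \<in> L"
      by blast
    then show "- x \<in> \<Union>C"
      using mem partial_sectionD(5) by blast
    assume "\<pi> x = 0"
    then show "x = 0"
      using L mem partial_sectionD(7) by blast
  next
    show "1 \<in> \<Union>C" "range (\<lambda>x. x ^ CHAR('k)) \<subseteq> \<Union>C"
      using assms(1) mem partial_sectionD(1,8) by blast+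
  qed
qed

lemma maximal_section_exists: "\<exists>L. maximal_section \<pi> L"
  using subset_Zorn_nonempty[of "{L. partial_section \<pi> L}"] partial_section_exists partial_section_Union
  unfolding maximal_section_def by blast

text \<open>
  The ring of all fractions of elements of $L$ with denominators outside the kernel is again a
  partial section, so a maximal $L$ contains it. In particular $L$ is a field.
\<close>
lemma maximal_section_fractions:
  assumes L: "maximal_section \<pi> L"
    and "s \<in> L" "z * s \<in> L" "\<pi> s \<noteq> 0"
  shows "z \<in> L"
proof -
  have sec: "partial_section \<pi> L"
    using L by (simp add: maximal_section_def)
  note LD = partial_sectionD[OF sec]
  define M where "M = {z. \<exists>s\<in>L. \<pi> s \<noteq> 0 \<and> z * s \<in> L}"
  have MI: "z \<in> M" if "s \<in> L" "\<pi> s \<noteq> 0" "z * s \<in> L" for z s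
    using that by (auto simp: M_def)
  have sub: "L \<subseteq> M"
    using LD(1) by (intro subsetI MI[of 1]) (auto simp: \<pi>_simps)
  have "partial_section \<pi> M"
    unfolding partial_section_def
  proof (intro conjI ballI impI)
    fix x y
    assume "x \<in> M" "y \<in> M"
    then obtain s t where s: "s \<in> L" "\<pi> s \<noteq> 0" "x * s \<in> L" and t: "t \<in> L" "\<pi> t \<noteq> 0" "y * t \<in> L"
      by (auto simp: M_def)
    have "(x + y) * (s * t) = (x * s) * t + (y * t) * s" "(x * y) * (s * t) = (x * s) * (y * t)"
      by (simp_all add: algebra_simps)
    then show "x + y \<in> M" "x * y \<in> M"
      using s t LD by (auto intro!: MI[of "s * t"] simp: \<pi>_simps)
  next
    fix x
    assume "x \<in> M"
    then obtain s where s: "s \<in> L" "\<pi> s \<noteq> 0" "x * s \<in> L"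
      by (auto simp: M_def)
    show "- x \<in> M"
      using s LD by (auto intro!: MI[of s])
    assume "\<pi> x = 0"
    then have "x * s = 0"
      using s LD by (simp add: \<pi>_simps)
    moreover obtain u where "s * u = 1"
      using s unit_if_\<pi>_nonzero by blast
    ultimately show "x = 0"
      by (metis mult.assoc mult.right_neutral mult_zero_left)
  next
    show "1 \<in> M" "range (\<lambda>x. x ^ CHAR('k)) \<subseteq> M"
      using sub LD by auto
  qed
  then have "M = L"
    using L sub by (simp add: maximal_section_def)
  then show ?thesis
    using MI assms by blast
qed

text \<open>
  The extension $L[r]$ is again a subring and contains the $p$-th powers, so injectivity of $\pi$
  is the only condition of a partial section that it can violate.
\<close>
lemma maximal_section_adjoin:
  assumes L: "maximal_section \<pi> L"
    and inj: "\<And>x. x \<in> adjoin L r \<Longrightarrow> \<pi> x = 0 \<Longrightarrow> x = 0"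
  shows "r \<in> L"
proof -
  have sec: "partial_section \<pi> L"
    using L by (simp add: maximal_section_def)
  note LD = partial_sectionD[OF sec]
  have scale: "c * x \<in> adjoin L r" if "x \<in> adjoin L r" "c \<in> L" for c x
    using that
  proof (induction rule: adjoin.induct)
    case (mult x)
    then show ?case
      by (metis adjoin.mult mult.left_commute)
  qed (auto simp: distrib_left intro: adjoin.intros LD)
  have prod: "x * y \<in> adjoin L r" if "x \<in> adjoin L r" "y \<in> adjoin L r" for x y
    using that
    by (induction rule: adjoin.induct) (auto simp: distrib_right mult.assoc intro: adjoin.intros scale)
  have sub: "L \<subseteq> adjoin L r"
    by (auto intro: adjoin.base)
  have "partial_section \<pi> (adjoin L r)"
    unfolding partial_section_def
  proof (intro conjI ballI impI)
    fix x
    assume x: "x \<in> adjoin L r"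
    show "- x \<in> adjoin L r"
      using scale[OF x LD(5)[OF LD(1)]] by simp
    show "x + y \<in> adjoin L r" "x * y \<in> adjoin L r" if "y \<in> adjoin L r" for y
      using x that adjoin.add prod by blast+
    show "x = 0" if "\<pi> x = 0"
      using x that inj by blast
  next
    show "1 \<in> adjoin L r" "range (\<lambda>x. x ^ CHAR('k)) \<subseteq> adjoin L r"
      using sub LD by auto
  qed
  then have "adjoin L r = L"
    using L sub by (simp add: maximal_section_def)
  then show ?thesis
    using adjoin.mult[OF adjoin.base[OF LD(1)], of r] by simp
qed

lemma poly_valuesI:
  assumes "x = (\<Sum>i<n. a i * r ^ i)" "range a \<subseteq> L"
  shows "x \<in> poly_values L r n"
  unfolding poly_values_def by (rule CollectI, rule exI[of _ a], rule conjI) (rule assms)+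

lemma poly_valuesE:
  assumes "x \<in> poly_values L r n"
  obtains a where "x = (\<Sum>i<n. a i * r ^ i)" "range a \<subseteq> L"
  using assms that unfolding poly_values_def by (elim CollectE exE conjE)

lemma poly_values_add:
  assumes "partial_section \<pi> L" "x \<in> poly_values L r n" "y \<in> poly_values L r n"
  shows "x + y \<in> poly_values L r n"
proof -
  obtain a where a: "x = (\<Sum>i<n. a i * r ^ i)" "range a \<subseteq> L"
    using assms(2) by (rule poly_valuesE)
  obtain b where b: "y = (\<Sum>i<n. b i * r ^ i)" "range b \<subseteq> L"
    using assms(3) by (rule poly_valuesE)
  have "x + y = (\<Sum>i<n. (a i + b i) * r ^ i)"
    by (simp only: a b distrib_right sum.distrib)
  moreover have "range (\<lambda>i. a i + b i) \<subseteq> L"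
    using a(2) b(2) partial_sectionD(3)[OF assms(1)] by (intro image_subsetI) (simp add: image_subset_iff)
  ultimately show ?thesis
    by (rule poly_valuesI)
qed

lemma poly_values_scale:
  assumes "partial_section \<pi> L" "x \<in> poly_values L r n" "c \<in> L"
  shows "c * x \<in> poly_values L r n"
proof -
  obtain a where a: "x = (\<Sum>i<n. a i * r ^ i)" "range a \<subseteq> L"
    using assms(2) by (rule poly_valuesE)
  have "c * x = (\<Sum>i<n. (c * a i) * r ^ i)"
    by (simp only: a sum_distrib_left mult.assoc)
  moreover have "range (\<lambda>i. c * a i) \<subseteq> L"
    using a(2) partial_sectionD(4)[OF assms(1) assms(3)] by (intro image_subsetI) (simp add: image_subset_iff)
  ultimately show ?thesis
    by (rule poly_valuesI)
qed

lemma poly_values_shift: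
  assumes "partial_section \<pi> L" "x \<in> poly_values L r n"
  shows "r * x \<in> poly_values L r (Suc n)"
proof -
  obtain a where a: "x = (\<Sum>i<n. a i * r ^ i)" "range a \<subseteq> L"
    using assms(2) by (rule poly_valuesE)
  define b where "b i = (case i of 0 \<Rightarrow> 0 | Suc j \<Rightarrow> a j)" for i
  have "r * x = (\<Sum>i<Suc n. b i * r ^ i)"
    by (simp add: a(1) b_def sum.lessThan_Suc_shift sum_distrib_left mult.left_commute
        del: sum.lessThan_Suc)
  moreover have "range b \<subseteq> L"
    using a(2) partial_sectionD(2)[OF assms(1)]
    by (simp add: image_subset_iff b_def split: nat.splits)
  ultimately show ?thesis
    by (rule poly_valuesI)
qed

lemma poly_values_mono:
  assumes "partial_section \<pi> L" "m \<le> n" "x \<in> poly_values L r m"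
  shows "x \<in> poly_values L r n"
proof -
  obtain a where a: "x = (\<Sum>i<m. a i * r ^ i)" "range a \<subseteq> L"
    using assms(3) by (rule poly_valuesE)
  define b where "b i = (if i < m then a i else 0)" for i
  have "x = (\<Sum>i<n. b i * r ^ i)"
    unfolding a(1) using assms(2) by (intro sum.mono_neutral_cong_left) (auto simp: b_def)
  moreover have "range b \<subseteq> L"
    using a(2) partial_sectionD(2)[OF assms(1)] by (simp add: image_subset_iff b_def)
  ultimately show ?thesis
    by (rule poly_valuesI)
qed

text \<open>
  An equation of degree $n$ for $r$ eliminates the power $r^n$; together with
  \<open>poly_values_shift\<close> this makes the values of degree less than $n$ closed under
  multiplication by $r$, so they exhaust $L[r]$.
\<close>
lemma poly_values_Suc_subset:
  assumes "partial_section \<pi> L" "r ^ n \<in> poly_values L r n" "x \<in> poly_values L r (Suc n)"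
  shows "x \<in> poly_values L r n"
proof -
  obtain a where a: "x = (\<Sum>i<Suc n. a i * r ^ i)" "range a \<subseteq> L"
    using assms(3) by (rule poly_valuesE)
  have "(\<Sum>i<n. a i * r ^ i) \<in> poly_values L r n"
    using a(2) by (intro poly_valuesI[OF refl])
  moreover have "a n * r ^ n \<in> poly_values L r n"
    using assms(1,2) a(2) by (intro poly_values_scale) (simp_all add: image_subset_iff)
  ultimately have "(\<Sum>i<n. a i * r ^ i) + a n * r ^ n \<in> poly_values L r n"
    by (rule poly_values_add[OF assms(1)])
  then show ?thesis
    by (simp add: a(1))
qed

lemma partial_section_poly_values:
  assumes "partial_section \<pi> L" "n > 0" "x \<in> L"
  shows "x \<in> poly_values L r n"
proof (rule poly_values_mono[OF assms(1)])
  have "x = (\<Sum>i<Suc 0. x * r ^ i)"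
    by simp
  then show "x \<in> poly_values L r (Suc 0)"
    by (rule poly_valuesI) (use assms(3) in auto)
qed (use assms(2) in simp)

lemma independent_powersD:
  assumes "independent_powers \<pi> L t n" "range a \<subseteq> L" "(\<Sum>i<n. \<pi> (a i) * t ^ i) = 0" "i < n"
  shows "\<pi> (a i) = 0"
  using assms unfolding independent_powers_def by metis

text \<open>
  If the powers of $\pi(r)$ are independent, an element $\sum a_i r^i$ of the kernel has
  $\pi(a_i) = 0$ for all $i$, and $\pi$ is injective on $L$.
\<close>
lemma poly_values_inj:
  assumes "partial_section \<pi> L" "independent_powers \<pi> L (\<pi> r) n" "x \<in> poly_values L r n" "\<pi> x = 0"
  shows "x = 0"
proof -
  obtain a where a: "x = (\<Sum>i<n. a i * r ^ i)" "range a \<subseteq> L"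
    using assms(3) by (rule poly_valuesE)
  have "(\<Sum>i<n. \<pi> (a i) * \<pi> r ^ i) = \<pi> x"
    by (simp add: a(1) \<pi>_simps)
  then have "\<pi> (a i) = 0" if "i < n" for i
    using independent_powersD[OF assms(2) a(2)] assms(4) that by simp
  then have "a i = 0" if "i < n" for i
    using that a(2) partial_sectionD(7)[OF assms(1), of "a i"] by (simp add: image_subset_iff)
  then show ?thesis
    by (simp add: a(1))
qed

lemma transcendental_adjoin:
  assumes L: "maximal_section \<pi> L" and indep: "\<And>n. independent_powers \<pi> L (\<pi> r) n"
  shows "r \<in> L"
proof (rule maximal_section_adjoin[OF L])
  have sec: "partial_section \<pi> L"
    using L by (simp add: maximal_section_def)
  fix x
  assume x: "x \<in> adjoin L r" "\<pi> x = 0"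
  have "\<exists>n. x \<in> poly_values L r n"
    using x(1)
  proof (induction rule: adjoin.induct)
    case (base x)
    then show ?case
      using partial_section_poly_values[OF sec zero_less_one] by blast
  next
    case (add x y)
    then obtain m n where mn: "x \<in> poly_values L r m" "y \<in> poly_values L r n"
      by blast
    have "x + y \<in> poly_values L r (max m n)"
      using poly_values_mono[OF sec max.cobounded1 mn(1)] poly_values_mono[OF sec max.cobounded2 mn(2)]
      by (rule poly_values_add[OF sec])
    then show ?case ..
  next
    case (mult x)
    then show ?case
      using poly_values_shift[OF sec] by blast
  qed
  then show "x = 0"
    using poly_values_inj[OF sec indep] x(2) by blast
qed

lemma algebraic_adjoin:
  assumes L: "maximal_section \<pi> L" and indep: "independent_powers \<pi> L (\<pi> r) n"
    and "n > 0" and root: "r ^ n \<in> poly_values L r n"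
  shows "r \<in> L"
proof (rule maximal_section_adjoin[OF L])
  have sec: "partial_section \<pi> L"
    using L by (simp add: maximal_section_def)
  fix x
  assume x: "x \<in> adjoin L r" "\<pi> x = 0"
  have "x \<in> poly_values L r n"
    using x(1)
  proof (induction rule: adjoin.induct)
    case (base x)
    then show ?case
      using partial_section_poly_values[OF sec \<open>n > 0\<close>] by blast
  next
    case (add x y)
    then show ?case
      using poly_values_add[OF sec] by blast
  next
    case (mult x)
    then show ?case
      using poly_values_shift[OF sec] poly_values_Suc_subset[OF sec root] by blast
  qed
  then show "x = 0"
    using poly_values_inj[OF sec indep] x(2) by blast
qed

text \<open>The binomial expansion stops after the linear term since $e^2 = 0$.\<close>
lemma power_add_kernel:
  assumes "\<pi> e = 0"
  shows "(r + e) ^ n = r ^ n + of_nat n * r ^ (n - 1) * e"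
proof (induction n)
  case (Suc n)
  have ee: "e * e = 0"
    using assms by (intro kernel_square_zero)
  have r: "r * (of_nat n * r ^ (n - 1)) = of_nat n * r ^ n"
    by (cases n) (simp_all add: mult.left_commute)
  have "(r + e) ^ Suc n = (r + e) * (r ^ n + of_nat n * r ^ (n - 1) * e)"
    by (simp add: Suc.IH)
  also have "\<dots> = r ^ Suc n + (r * (of_nat n * r ^ (n - 1)) + r ^ n) * e + of_nat n * r ^ (n - 1) * (e * e)"
    by (simp add: algebra_simps)
  also have "\<dots> = r ^ Suc n + (of_nat n * r ^ n + r ^ n) * e"
    by (simp only: ee r mult_zero_right add_0_right)
  finally show ?case
    by (simp add: algebra_simps)
qed simp

text \<open>
  One Newton step: with $q(T) = T^n - \sum a_i T^i$ one has $q(r + e) = q(r) + q'(r)e$ without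
  error term for $e$ in the kernel, and $q'(r)$ is a unit, so $e = -q(r)/q'(r)$ gives a root.
\<close>
lemma lift_simple_root:
  fixes a :: "nat \<Rightarrow> 'a"
  assumes root: "\<pi> (r ^ n - (\<Sum>i<n. a i * r ^ i)) = 0"
    and simple: "\<pi> (of_nat n * r ^ (n - 1) - (\<Sum>i<n. a i * (of_nat i * r ^ (i - 1)))) \<noteq> 0"
  obtains r' where "\<pi> r' = \<pi> r" "r' ^ n = (\<Sum>i<n. a i * r' ^ i)"
proof -
  define q where "q = r ^ n - (\<Sum>i<n. a i * r ^ i)"
  define q' where "q' = of_nat n * r ^ (n - 1) - (\<Sum>i<n. a i * (of_nat i * r ^ (i - 1)))"
  obtain u where u: "q' * u = 1"
    using unit_if_\<pi>_nonzero simple unfolding q'_def by blast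
  define e where "e = - (u * q)"
  have e: "\<pi> e = 0"
    using root by (simp add: e_def q_def \<pi>_uminus \<pi>_mult)
  have "(r + e) ^ n - (\<Sum>i<n. a i * (r + e) ^ i) = q + q' * e"
    unfolding power_add_kernel[OF e] q_def q'_def
    by (simp add: algebra_simps sum.distrib sum_distrib_left sum_distrib_right)
  also have "q' * e = - q"
    using u by (simp add: e_def flip: mult.assoc)
  finally have "(r + e) ^ n = (\<Sum>i<n. a i * (r + e) ^ i)"
    by simp
  moreover have "\<pi> (r + e) = \<pi> r"
    by (simp add: \<pi>_add e)
  ultimately show thesis
    using that by blast
qed

text \<open>
  The derivative is a polynomial in $t$ of degree $n-1$ with leading coefficient $n \neq 0$, so it
  cannot vanish when the powers below $n$ are independent.
\<close>
lemma derivative_nonzero: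
  assumes sec: "partial_section \<pi> L" and "independent_powers \<pi> L t n" "range a \<subseteq> L" "of_nat n \<noteq> (0 :: 'k)"
  shows "of_nat n * t ^ (n - 1) - (\<Sum>i<n. \<pi> (a i) * (of_nat i * t ^ (i - 1))) \<noteq> 0"
proof
  note LD = partial_sectionD[OF sec]
  obtain m where n: "n = Suc m"
    using assms(4) by (cases n) auto
  \<comment> \<open>The coefficients of the derivative, with the degrees shifted down by one.\<close>
  define b where "b i = (if i = m then of_nat n else - (a (Suc i) * of_nat (Suc i)))" for i
  have "range b \<subseteq> L"
    using assms(3) by (simp add: b_def image_subset_iff LD of_nat_in_partial_section[OF sec] del: of_nat_Suc)
  assume "of_nat n * t ^ (n - 1) - (\<Sum>i<n. \<pi> (a i) * (of_nat i * t ^ (i - 1))) = 0"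
  moreover have "(\<Sum>i<n. \<pi> (a i) * (of_nat i * t ^ (i - 1))) = - (\<Sum>i<m. \<pi> (b i) * t ^ i)"
    by (simp add: n comm_monoid_add_class.sum.lessThan_Suc_shift b_def \<pi>_uminus \<pi>_mult \<pi>_of_nat
        sum_negf semigroup_mult_class.mult.assoc
        del: comm_monoid_add_class.sum.lessThan_Suc semiring_1_class.of_nat_Suc of_nat_Suc)
  ultimately have "(\<Sum>i<n. \<pi> (b i) * t ^ i) = 0"
    by (simp add: n b_def \<pi>_of_nat ab_semigroup_add_class.add.commute del: semiring_1_class.of_nat_Suc of_nat_Suc)
  then have "\<pi> (b m) = 0"
    by (rule independent_powersD[OF assms(2) \<open>range b \<subseteq> L\<close>]) (simp add: n)
  then show False
    using assms(4) by (simp add: b_def \<pi>_of_nat)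
qed

text \<open>
  For $t$ algebraic over the image of $L$, let $n$ be its degree. If $n \neq 0$ in the field, the
  minimal equation is separable and \<open>lift_simple_root\<close> yields a lift that satisfies it. If $n = 0$
  in the field, then $p$ divides $n$; as $t^p$ lies in the image of $L$, also $n \le p$. So
  $n = p$, and $r^n \in L$ for every lift $r$.
\<close>
lemma maximal_section_surj:
  assumes L: "maximal_section \<pi> L"
  shows "\<pi> ` L = UNIV"
proof (intro equalityI subset_UNIV subsetI)
  fix t
  have sec: "partial_section \<pi> L"
    using L by (simp add: maximal_section_def)
  note LD = partial_sectionD[OF sec]
  obtain r where r: "\<pi> r = t"
    by (metis surj_\<pi> surjD)
  show "t \<in> \<pi> ` L"
  proof (cases "\<forall>n. independent_powers \<pi> L t n")
    case True
    then show ?thesis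
      using transcendental_adjoin[OF L] r by blast
  next
    case False
    have "independent_powers \<pi> L t 0"
      by (simp add: independent_powers_def)
    then obtain n where n: "independent_powers \<pi> L t n" "\<not> independent_powers \<pi> L t (Suc n)"
      using False by (metis nat_induct)
    obtain b where b: "range b \<subseteq> L" "(\<Sum>i<Suc n. \<pi> (b i) * t ^ i) = 0" "\<exists>i<Suc n. \<pi> (b i) \<noteq> 0"
      using n(2) unfolding independent_powers_def by blast
    have lead: "\<pi> (b n) \<noteq> 0"
    proof
      assume "\<pi> (b n) = 0"
      then have "\<forall>i<n. \<pi> (b i) = 0"
        using independent_powersD[OF n(1) b(1)] b(2) by simp
      then show False
        using b(3) \<open>\<pi> (b n) = 0\<close> less_Suc_eq by auto
    qed
    have "n > 0"
      using lead b(2) by (cases n) auto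
    obtain u where u: "b n * u = 1"
      using lead unit_if_\<pi>_nonzero by blast
    then have "u \<in> L"
      using maximal_section_fractions[OF L, of "b n" u] b(1) lead LD(1) by (auto simp: mult.commute)
    \<comment> \<open>The relation is made monic by dividing by its leading coefficient.\<close>
    define a where "a i = - (u * b i)" for i
    have a: "range a \<subseteq> L"
      using \<open>u \<in> L\<close> b(1) LD by (auto simp: a_def)
    have u': "\<pi> u * \<pi> (b n) = 1"
      using u by (metis \<pi>_mult \<pi>_one mult.commute)
    have "(\<Sum>i<n. \<pi> u * (\<pi> (b i) * t ^ i)) + (\<pi> u * \<pi> (b n)) * t ^ n
        = \<pi> u * (\<Sum>i<Suc n. \<pi> (b i) * t ^ i)"
      by (simp add: semiring_class.distrib_left semiring_0_class.sum_distrib_left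
          semigroup_mult_class.mult.assoc)
    then have "(\<Sum>i<n. \<pi> u * (\<pi> (b i) * t ^ i)) + t ^ n = 0"
      unfolding b(2) u' by simp
    then have tn: "t ^ n = (\<Sum>i<n. \<pi> (a i) * t ^ i)"
      by (simp add: a_def \<pi>_uminus \<pi>_mult sum_negf semigroup_mult_class.mult.assoc
          group_add_class.eq_neg_iff_add_eq_0 ab_semigroup_add_class.add.commute)
    show ?thesis
    proof (cases "of_nat n = (0 :: 'k)")
      case False
      have "\<pi> (r ^ n - (\<Sum>i<n. a i * r ^ i)) = 0"
        by (simp add: \<pi>_simps r tn)
      moreover have "\<pi> (of_nat n * r ^ (n - 1) - (\<Sum>i<n. a i * (of_nat i * r ^ (i - 1)))) \<noteq> 0"
        using derivative_nonzero[OF sec n(1) a False] by (simp add: \<pi>_simps r)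
      ultimately obtain r' where r': "\<pi> r' = \<pi> r" "r' ^ n = (\<Sum>i<n. a i * r' ^ i)"
        by (rule lift_simple_root)
      have "r' \<in> L"
        using n(1) by (intro algebraic_adjoin[OF L _ \<open>n > 0\<close>] poly_valuesI[OF r'(2) a]) (simp add: r r'(1))
      then show ?thesis
        by (rule image_eqI[rotated]) (simp add: r r'(1))
    next
      case True
      define p where "p = CHAR('k)"
      have "p dvd n"
        using True by (simp add: p_def semiring_1_class.of_nat_eq_0_iff_char_dvd)
      then have "p \<le> n" "p > 0"
        using \<open>n > 0\<close> by (auto intro: dvd_imp_le Nat.gr0I)
      have "\<not> p < n"
      proof
        assume "p < n"
        \<comment> \<open>Lifts of the coefficients of $T^p - t^p$, whose degree is less than $n$.\<close>
        define c where "c i = (if i = 0 then - (r ^ p) else if i = p then 1 else 0)" for i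
        have c: "range c \<subseteq> L"
          by (simp add: image_subset_iff c_def p_def LD)
        have "(\<Sum>i<n. \<pi> (c i) * t ^ i) = (\<Sum>i\<in>{0, p}. \<pi> (c i) * t ^ i)"
          using \<open>p < n\<close> by (intro comm_monoid_add_class.sum.mono_neutral_right) (auto simp: c_def \<pi>_zero)
        also have "\<dots> = 0"
          using \<open>p > 0\<close> by (simp add: c_def \<pi>_simps r)
        finally have "\<pi> (c p) = 0"
          using independent_powersD[OF n(1) c] \<open>p < n\<close> by blast
        then show False
          using \<open>p > 0\<close> by (simp add: c_def \<pi>_one)
      qed
      then have "n = p"
        using \<open>p \<le> n\<close> by simp
      then have "r ^ n \<in> poly_values L r n"
        using partial_section_poly_values[OF sec \<open>n > 0\<close>] LD(8) by (simp add: p_def)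
      then have "r \<in> L"
        using n(1) by (intro algebraic_adjoin[OF L _ \<open>n > 0\<close>]) (simp_all add: r)
      then show ?thesis
        by (rule image_eqI[rotated]) (simp add: r)
    qed
  qed
qed

theorem coefficient_field_exists:
  obtains \<sigma> :: "'k \<Rightarrow> 'a" where "\<And>x. \<pi> (\<sigma> x) = x"
    "\<And>x y. \<sigma> (x + y) = \<sigma> x + \<sigma> y" "\<And>x y. \<sigma> (x * y) = \<sigma> x * \<sigma> y"
proof -
  obtain L where L: "maximal_section \<pi> L"
    using maximal_section_exists by blast
  then have sec: "partial_section \<pi> L"
    by (simp add: maximal_section_def)
  note LD = partial_sectionD[OF sec]
  have inj: "x = y" if "x \<in> L" "y \<in> L" "\<pi> x = \<pi> y" for x y
    using LD(7)[OF LD(6)[OF that(1,2)]] that(3) by (simp add: \<pi>_diff)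
  define \<sigma> where "\<sigma> = inv_into L \<pi>"
  have "t \<in> \<pi> ` L" for t
    by (simp add: maximal_section_surj[OF L])
  then have \<sigma>: "\<sigma> t \<in> L" "\<pi> (\<sigma> t) = t" for t
    by (simp_all only: \<sigma>_def inv_into_into f_inv_into_f)
  show thesis
  proof (rule that)
    show "\<pi> (\<sigma> x) = x" "\<sigma> (x + y) = \<sigma> x + \<sigma> y" "\<sigma> (x * y) = \<sigma> x * \<sigma> y" for x y
      by (rule \<sigma> inj; simp add: \<sigma> LD(3,4) \<pi>_add \<pi>_mult)+
  qed
qed

end

end

section \<open>Symmetric Hochschild cocycles of a field\<close>

locale hochschild_cocycle = vector_space scale
  for scale :: "'a::field \<Rightarrow> 'b::ab_group_add \<Rightarrow> 'b" (infixr \<open>\<cdot>\<close> 75) +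
  fixes G :: "'a \<Rightarrow> 'a \<Rightarrow> 'b"
  assumes commute: "G x y = G y x"
    and hochschild: "G (x * y) z + z \<cdot> G x y = G x (y * z) + x \<cdot> G y z"
begin

lemma one_left: "G 1 x = x \<cdot> G 1 1"
  using hochschild[of 1 1 x] by simp

text \<open>
  The additivity defect $T(x,y,z) = G(x+y,z) - G(x,z) - G(y,z)$ is symmetric in $x, y$, and by
  the additive cocycle identity also under cyclic shifts. The Hochschild identity gives
  $T(x,y,wz) = T(xw,yw,z) + zT(x,y,w)$. Now $T$ vanishes as soon as one argument is $1$, because
  $G(x,1) = xG(1,1)$; so putting $x = 1$ leaves $T(w,yw,z) = 0$, and every triple with $w \neq 0$ in
  the first place has this form. By symmetry only the triples $(0,0,z)$ remain, and they have it
  with $w = 0$.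
\<close>
lemma biadditive_if_additive_cocycle:
  assumes cocycle: "\<And>x y z. G (x + y) z + G x y = G x (y + z) + G y z"
  shows "G (x + y) z = G x z + G y z"
proof -
  define T where "T x y z = G (x + y) z - G x z - G y z" for x y z
  have swap: "T x y z = T y x z" for x y z
    by (simp add: T_def add.commute)
  have rotate: "T x y z = T y z x" for x y z
    using cocycle[of x y z] commute[of "y + z" x] commute[of y x] commute[of z x]
    by (simp add: T_def algebra_simps)
  have T_mult: "T x y (w * z) = T (x * w) (y * w) z + z \<cdot> T x y w" for x y w z
    using hochschild[of x w z] hochschild[of y w z] hochschild[of "x + y" w z]
    by (simp add: T_def algebra_simps)
  have one_right: "G x 1 = x \<cdot> G 1 1" for x
    using one_left[of x] commute[of x 1] by simp
  have "T x y 1 = 0" for x y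
    unfolding T_def one_right[of x] one_right[of y] one_right[of "x + y"]
    by (simp add: scale_left_distrib)
  then have T_one: "T 1 y z = 0" for y z
    by (simp add: rotate[of 1 y z])
  have zero: "T w (y * w) z = 0" for w y z
    using T_mult[of 1 y w z] by (simp add: T_one)
  have nonzero: "T x y z = 0" if "x \<noteq> 0" for x y z
    using zero[of x "y / x" z] that by simp
  have "T x y z = 0"
    using nonzero[of x y z] nonzero[of y x z] zero[of 0 0 z] swap[of x y z] by (cases "x = 0"; cases "y = 0") auto
  then show ?thesis
    by (simp add: T_def algebra_simps)
qed

text \<open>
  The multiplication of the extension of the field by the square-zero ideal $X$ that belongs to
  the cocycle $G$.
\<close>
definition twisted_mult :: "'a \<times> 'b \<Rightarrow> 'a \<times> 'b \<Rightarrow> 'a \<times> 'b" where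
  "twisted_mult r s = (fst r * fst s, fst r \<cdot> snd s + fst s \<cdot> snd r + G (fst r) (fst s))"

text \<open>
  The Hochschild identity is the associativity of the twisted multiplication, symmetry its
  commutativity, biadditivity its distributivity; the unit is $(1, -G(1,1))$. The second component
  of a multiplicative and additive section is the required $\alpha$.
\<close>
theorem coboundary_if_biadditive:
  assumes add: "\<And>x y z. G (x + y) z = G x z + G y z"
  obtains \<alpha> where "Modules.additive \<alpha>" "\<And>x y. G x y = \<alpha> (x * y) - x \<cdot> \<alpha> y - y \<cdot> \<alpha> x"
proof -
  have assoc: "twisted_mult (twisted_mult r s) t = twisted_mult r (twisted_mult s t)" for r s t
    using hochschild[of "fst r" "fst s" "fst t"]
    by (simp add: twisted_mult_def algebra_simps)
  have comm: "twisted_mult r s = twisted_mult s r" for r s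
    by (simp add: twisted_mult_def commute[of "fst r"] algebra_simps)
  have one: "twisted_mult (1, - G 1 1) r = r" for r
    using one_left[of "fst r"] by (simp add: twisted_mult_def)
  have distrib: "twisted_mult (r + s) t = twisted_mult r t + twisted_mult s t" for r s t
    by (simp add: twisted_mult_def add plus_prod_def algebra_simps)
  interpret R: comm_ring_1 twisted_mult "(1, - G 1 1)" "(+)" 0 "(-)" uminus
    by unfold_locales (rule assoc comm one distrib | simp add: zero_prod_def)+
  have of_nat: "R.of_nat n = (of_nat n, of_nat n \<cdot> (- G 1 1))" for n
    by (induction n) (simp_all add: prod_eq_iff algebra_simps)
  have G_zero: "G 0 0 = 0"
    using add[of 0 0 0] by simp
  obtain \<sigma> where \<sigma>: "\<And>x. fst (\<sigma> x) = x" "\<And>x y. \<sigma> (x + y) = \<sigma> x + \<sigma> y"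
    "\<And>x y. \<sigma> (x * y) = twisted_mult (\<sigma> x) (\<sigma> y)"
  proof (rule R.coefficient_field_exists[of fst])
    show "R.of_nat CHAR('a) = 0"
      by (simp add: of_nat prod_eq_iff)
    show "surj (fst :: 'a \<times> 'b \<Rightarrow> 'a)"
      by (rule surjI[of _ "\<lambda>x. (x, 0)"]) simp
    show "twisted_mult r s = 0" if "fst r = 0" "fst s = 0" for r s
      using that by (simp add: twisted_mult_def zero_prod_def G_zero)
  qed (rule that | simp add: twisted_mult_def)+
  show thesis
  proof (rule that[of "\<lambda>x. snd (\<sigma> x)"])
    show "Modules.additive (\<lambda>x. snd (\<sigma> x))"
      by unfold_locales (simp add: \<sigma>(2))
    show "G x y = snd (\<sigma> (x * y)) - x \<cdot> snd (\<sigma> y) - y \<cdot> snd (\<sigma> x)" for x y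
      by (simp add: \<sigma>(1,3) twisted_mult_def)
  qed
qed

end

section \<open>The functional equation\<close>

context vector_space
begin

lemma half_sum_self:
  assumes "(2 :: 'a) \<noteq> 0"
  shows "scale (1 / 2) (x + x) = x"
proof -
  have "x + x = scale 2 x"
    using scale_left_distrib[of 1 1 x] by simp
  then show ?thesis
    using assms by simp
qed

text \<open>
  Expanding $\alpha((x+y)^2)$ leaves $2\alpha(xy)$ as mixed term, and the mixed terms of
  $x\alpha(x)$ are $x\alpha(y)$ and $y\alpha(x)$.
\<close>
lemma quadratic_part_defect:
  assumes "(2 :: 'a) \<noteq> 0" and "Modules.additive \<alpha>"
    and q: "\<And>x. q x = scale (1 / 2) (\<alpha> (x\<^sup>2)) - scale x (\<alpha> x)"
  shows "q (x + y) - q x - q y = \<alpha> (x * y) - scale x (\<alpha> y) - scale y (\<alpha> x)"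
proof -
  interpret \<alpha>: Modules.additive \<alpha> by fact
  have "(x + y)\<^sup>2 = x\<^sup>2 + (x * y + x * y) + y\<^sup>2"
    by (simp add: power2_eq_square algebra_simps)
  then have "scale (1 / 2) (\<alpha> ((x + y)\<^sup>2))
      = scale (1 / 2) (\<alpha> (x\<^sup>2)) + \<alpha> (x * y) + scale (1 / 2) (\<alpha> (y\<^sup>2))"
    by (simp only: \<alpha>.add scale_right_distrib[of _ "_ + _" "\<alpha> (y\<^sup>2)"]
        scale_right_distrib[of _ "\<alpha> (x\<^sup>2)"] half_sum_self[OF assms(1)])
  then show ?thesis
    by (simp add: q \<alpha>.add algebra_simps)
qed

end

theorem theorem2p1:
  fixes scale :: "'a::field \<Rightarrow> 'b::ab_group_add \<Rightarrow> 'b"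
    and f g :: "'a \<Rightarrow> 'b"
  assumes "vector_space scale"
    and "(2::'a) \<noteq> 0"
  shows "(\<forall>x y. f (x + y) - f x - f y = g (x * y) - scale x (g y) - scale y (g x)) \<longleftrightarrow>
    (\<exists>\<alpha> \<beta> \<phi>. Modules.additive \<alpha> \<and> Modules.additive \<beta> \<and>
      (\<forall>x y. \<phi> (x * y) = scale x (\<phi> y) + scale y (\<phi> x)) \<and>
      (\<forall>x. f x = \<beta> x + scale (1 / 2) (\<alpha> (x\<^sup>2)) - scale x (\<alpha> x)) \<and>
      (\<forall>x. g x = \<phi> x + \<alpha> x))"
  (is "?equation \<longleftrightarrow> ?solution")
proof -
  interpret vector_space scale by fact
  show ?thesis
  proof
    assume eq: ?equation
    define G where "G x y = g (x * y) - scale x (g y) - scale y (g x)" for x y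
    have f: "f (x + y) - f x - f y = G x y" for x y
      using eq by (simp add: G_def)
    interpret hochschild_cocycle scale G
      by unfold_locales (simp_all add: G_def algebra_simps)
    have "G (x + y) z + G x y = G x (y + z) + G y z" for x y z
      by (simp add: algebra_simps flip: f)
    then have "G (x + y) z = G x z + G y z" for x y z
      by (rule biadditive_if_additive_cocycle)
    then obtain \<alpha> where \<alpha>: "Modules.additive \<alpha>"
        "\<And>x y. G x y = \<alpha> (x * y) - scale x (\<alpha> y) - scale y (\<alpha> x)"
      by (rule coboundary_if_biadditive) (rule that)
    define q where "q x = scale (1 / 2) (\<alpha> (x\<^sup>2)) - scale x (\<alpha> x)" for x
    have "q (x + y) - q x - q y = G x y" for x y
      unfolding \<alpha>(2) by (rule quadratic_part_defect[OF assms(2) \<alpha>(1) q_def])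
    then have "f (x + y) - f x - f y = q (x + y) - q x - q y" for x y
      by (simp add: f)
    then have "Modules.additive (\<lambda>x. f x - q x)"
      by unfold_locales (simp add: algebra_simps)
    moreover have "g (x * y) - \<alpha> (x * y) = scale x (g y - \<alpha> y) + scale y (g x - \<alpha> x)" for x y
      using \<alpha>(2)[of x y] by (simp add: G_def algebra_simps)
    ultimately show ?solution
      using \<alpha>(1)
      by (intro exI[of _ \<alpha>] exI[of _ "\<lambda>x. f x - q x"] exI[of _ "\<lambda>x. g x - \<alpha> x"])
        (simp add: q_def)
  next
    assume ?solution
    then obtain \<alpha> \<beta> \<phi> where \<alpha>: "Modules.additive \<alpha>" and "Modules.additive \<beta>"
      and \<phi>: "\<And>x y. \<phi> (x * y) = scale x (\<phi> y) + scale y (\<phi> x)"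
      and f: "\<And>x. f x = \<beta> x + scale (1 / 2) (\<alpha> (x\<^sup>2)) - scale x (\<alpha> x)"
      and g: "\<And>x. g x = \<phi> x + \<alpha> x"
      by blast
    interpret \<beta>: Modules.additive \<beta> by fact
    have "f (x + y) - f x - f y = \<alpha> (x * y) - scale x (\<alpha> y) - scale y (\<alpha> x)" for x y
      using quadratic_part_defect[OF assms(2) \<alpha> refl, of x y]
      by (simp add: f \<beta>.add algebra_simps)
    then show ?equation
      by (simp add: g \<phi> algebra_simps)
  qed
qed

end
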